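(* Let $t\geq 1$ and let $G$ be a graph with the $t$-cleavage property. Let $T$ be the bipartite graph whose vertex classes are the set of $(t+1)$-blocks of $G$ and the set of $t$-vertex separators of $G$, in which a $(t+1)$-block $D$ and a $t$-vertex separator $X$ are adjacent if and only if $X\subseteq V(D)$. Then $T$ is a tree.
   Context: A $t$-vertex separator of a connected graph $G$ is a set $X\subseteq V(G)$ with $|X|=t$ such that $G-X$ is disconnected. $G$ has the $t$-cleavage property if $G$ is $t$-connected and every $t$-vertex separator of $G$ induces a complete subgraph (clique) of $G$. A $(t+1)$-block of such a $G$ is a subgraph $D$ which is either isomorphic to $K_{t+1}$ or $(t+1)$-connected, and which is maximal with respect to inclusion subject to this condition. *)

theory Defs
  imports "Graph_Theory.Graph_Theory"
begin

text \<open>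
  A simple graph, finite or infinite, is a pair digraph satisfying
  \<^locale>\<open>pair_bidirected_digraph\<close>: every undirected edge is represented by its two opposite arcs.
\<close>

definition delete_verts :: "('a, 'b) pre_digraph \<Rightarrow> 'a set \<Rightarrow> ('a, 'b) pre_digraph" where
  "delete_verts G X = G \<restriction> (verts G - X)"

text \<open>
  The library notion \<^const>\<open>connected\<close> fails for the graph without vertices, which is
  nevertheless not counted as disconnected.
\<close>

definition disconnected :: "('a, 'b) pre_digraph \<Rightarrow> bool" where
  "disconnected G \<longleftrightarrow> verts G \<noteq> {} \<and> \<not> connected G"

text \<open>
  The usual convention: a \<^term>\<open>k\<close>-connected graph has more than \<^term>\<open>k\<close> vertices,
  so the complete graph on \<^term>\<open>n\<close> vertices is (n-1)-connected but not n-connected.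
\<close>

definition k_connected :: "nat \<Rightarrow> ('a, 'b) pre_digraph \<Rightarrow> bool" where
  "k_connected k G \<longleftrightarrow>
     (infinite (verts G) \<or> k < card (verts G)) \<and>
     (\<forall>X. X \<subseteq> verts G \<and> finite X \<and> card X < k \<longrightarrow> connected (delete_verts G X))"

definition vertex_separator :: "nat \<Rightarrow> ('a, 'b) pre_digraph \<Rightarrow> 'a set \<Rightarrow> bool" where
  "vertex_separator t G X \<longleftrightarrow>
     X \<subseteq> verts G \<and> finite X \<and> card X = t \<and> disconnected (delete_verts G X)"

definition cleavage_property :: "nat \<Rightarrow> ('a, 'b) pre_digraph \<Rightarrow> bool" where
  "cleavage_property t G \<longleftrightarrow>
     k_connected t G \<and> (\<forall>X. vertex_separator t G X \<longrightarrow> complete_digraph t (G \<restriction> X))"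

text \<open>
  \<^term>\<open>block k G D\<close> says that \<^term>\<open>D\<close> is a k-block of \<^term>\<open>G\<close>. The symmetry condition
  restricts the subdigraphs considered by \<^const>\<open>pre_digraph.max_subgraph\<close> to undirected subgraphs.
\<close>

definition block :: "nat \<Rightarrow> 'a pair_pre_digraph \<Rightarrow> 'a pair_pre_digraph \<Rightarrow> bool" where
  "block k G D \<longleftrightarrow>
     pre_digraph.max_subgraph (with_proj G)
       (\<lambda>H. symmetric H \<and> (complete_digraph k H \<or> k_connected k H)) (with_proj D)"

definition block_separator_graph ::
    "nat \<Rightarrow> 'a pair_pre_digraph \<Rightarrow> ('a pair_pre_digraph + 'a set) pair_pre_digraph" where
  "block_separator_graph t G =
     \<lparr> pverts = Inl ` {D. block (t + 1) G D} \<union> Inr ` {X. vertex_separator t (with_proj G) X},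
       parcs = (\<Union>(D, X) \<in> {(D, X). block (t + 1) G D \<and> vertex_separator t (with_proj G) X
                                     \<and> X \<subseteq> pverts D}.
                  {(Inl D, Inr X), (Inr X, Inl D)}) \<rparr>"

text \<open>
  The library predicate \<^const>\<open>tree\<close> concerns directed cycles, and in a symmetric digraph every
  edge is a directed cycle of length 2. Undirected cycles are the directed ones of length at least 3.
\<close>

definition undirected_tree :: "'a pair_pre_digraph \<Rightarrow> bool" where
  "undirected_tree T \<longleftrightarrow>
     pair_bidirected_digraph T \<and> connected (with_proj T) \<and>
     \<not> (\<exists>p. pre_digraph.cycle (with_proj T) p \<and> 3 \<le> length p)"

end

theory Submission
  imports Defs
begin

text \<open>
  Call a vertex set inseparable if no \<open>t\<close>-vertex separator has two of its vertices in different
  components. Since separators are cliques, walks between vertices of a maximal inseparable set \<open>B\<close>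
  can be shortened until they stay in \<open>B\<close>; hence the \<open>(t+1)\<close>-blocks are exactly the graphs induced
  by the maximal inseparable sets with more than \<open>t\<close> vertices. Every separator \<open>X\<close> lies in a block
  reaching into any prescribed component of \<open>G - X\<close>. Only finitely many separators lie between two
  blocks, even if \<open>G\<close> is infinite, and cutting along one of them leaves fewer, which gives
  connectedness of the tree by induction. It has no cycle because two blocks that both contain \<open>X\<close>
  lie in different components of \<open>G - X\<close>, whereas a walk in the tree that avoids \<open>X\<close> never leaves
  a component of \<open>G - X\<close>.
\<close>

section \<open>Walks and reachability inside a vertex set\<close>

text \<open>Its relational powers count steps, which \<open>rtrancl_on\<close> does not record; the
  shortening arguments induct on this count.\<close>

definition walk_step :: "'a rel \<Rightarrow> 'a set \<Rightarrow> 'a rel" where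
  "walk_step E W = E \<inter> W \<times> W"

lemma rtrancl_on_imp_walk:
  "(u, v) \<in> rtrancl_on W E \<Longrightarrow> \<exists>n. (u, v) \<in> walk_step E W ^^ n"
proof (induct rule: rtrancl_on_induct)
  case base
  then show ?case by (intro exI[of _ 0]) simp
next
  case (step y z)
  then obtain n where "(u, y) \<in> walk_step E W ^^ n" by blast
  then have "(u, z) \<in> walk_step E W ^^ Suc n"
    using step by (auto simp: walk_step_def)
  then show ?case by blast
qed

text \<open>Either the walk never enters \<open>X\<close>, or it is cut at its first vertex in
  \<open>X\<close>. The remainder is strictly shorter because \<open>w\<close> itself lies outside
  \<open>X\<close>.\<close>

lemma walk_meets:
  assumes "(w, v) \<in> walk_step E W ^^ n" "w \<in> W" "W \<subseteq> V" "w \<notin> X"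
  shows "(w, v) \<in> rtrancl_on (V - X) E \<or> (\<exists>z \<in> X \<inter> W. \<exists>m < n. (z, v) \<in> walk_step E W ^^ m)"
  using assms
proof (induct n arbitrary: w)
  case 0
  then show ?case by auto
next
  case (Suc n)
  from Suc.prems(1) obtain w' where w': "(w, w') \<in> walk_step E W" "(w', v) \<in> walk_step E W ^^ n"
    by (meson relpow_Suc_D2)
  then have W: "w' \<in> W" "(w, w') \<in> E" by (auto simp: walk_step_def)
  show ?case
  proof (cases "w' \<in> X")
    case True
    then show ?thesis using w' W by blast
  next
    case False
    from Suc.hyps[OF w'(2) W(1) Suc.prems(3) False] show ?thesis
    proof
      assume "(w', v) \<in> rtrancl_on (V - X) E"
      then have "(w, v) \<in> rtrancl_on (V - X) E"
        using W Suc.prems by (intro converse_rtrancl_on_into_rtrancl_on[of w w']) auto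
      then show ?thesis by blast
    next
      assume "\<exists>z \<in> X \<inter> W. \<exists>m < n. (z, v) \<in> walk_step E W ^^ m"
      then show ?thesis using less_SucI by blast
    qed
  qed
qed

text \<open>A walk visits only finitely many vertices. In an infinite graph this bounds the choices
  in \<open>finite_separators_between_aux\<close>.\<close>

lemma rtrancl_on_finite_support:
  "(u, v) \<in> rtrancl_on W E \<Longrightarrow> \<exists>P. finite P \<and> P \<subseteq> W \<and> (u, v) \<in> rtrancl_on P E"
proof (induct rule: rtrancl_on_induct)
  case base
  then show ?case by (intro exI[of _ "{u}"]) auto
next
  case (step y z)
  then obtain P where P: "finite P" "P \<subseteq> W" "(u, y) \<in> rtrancl_on P E" by blast
  then have "(u, y) \<in> rtrancl_on (insert z P) E"
    by (blast intro: rtrancl_on_mono[of E E P])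
  then have "(u, z) \<in> rtrancl_on (insert z P) E"
    using step by (blast intro: rtrancl_on_into_rtrancl_on)
  then show ?case using P step by (intro exI[of _ "insert z P"]) auto
qed

lemma connected_iff_rtrancl_on:
  assumes "wf_digraph H" "symmetric H"
  shows "connected H \<longleftrightarrow> verts H \<noteq> {} \<and>
    (\<forall>u \<in> verts H. \<forall>v \<in> verts H. (u, v) \<in> rtrancl_on (verts H) (arcs_ends H))"
  using wf_digraph.adj_mk_symmetric_eq[OF assms]
  by (simp add: connected_def strongly_connected_def reachable_def)

lemma rtrancl_on_restrict: "rtrancl_on W (E \<inter> W \<times> W) = rtrancl_on W E"
proof -
  have "(u, v) \<in> rtrancl_on W (E \<inter> W \<times> W)" if "(u, v) \<in> rtrancl_on W E" for u v
    using that by (induct rule: rtrancl_on_induct) (auto intro: rtrancl_on_into_rtrancl_on)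
  moreover have "(u, v) \<in> rtrancl_on W E" if "(u, v) \<in> rtrancl_on W (E \<inter> W \<times> W)" for u v
    using that by (blast intro: rtrancl_on_mono[of "E \<inter> W \<times> W" E W W])
  ultimately show ?thesis by auto
qed

lemma arcs_ends_induce_subgraph: "arcs_ends (H \<restriction> W) = arcs_ends H \<inter> W \<times> W"
  by (auto simp: arcs_ends_conv)

lemma symmetric_induce_subgraph: "symmetric H \<Longrightarrow> symmetric (H \<restriction> W)"
  by (auto simp: symmetric_def arcs_ends_induce_subgraph sym_def)

lemma connected_induce_subgraph_iff:
  assumes "wf_digraph H" "symmetric H"
  shows "connected (H \<restriction> W) \<longleftrightarrow>
    W \<noteq> {} \<and> (\<forall>u \<in> W. \<forall>v \<in> W. (u, v) \<in> rtrancl_on W (arcs_ends H))"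
  using connected_iff_rtrancl_on[OF wf_digraph.wellformed_induce_subgraph[OF assms(1)]
      symmetric_induce_subgraph[OF assms(2)], of W]
  by (simp add: arcs_ends_induce_subgraph rtrancl_on_restrict)

lemma pcas_append: "pcas u (p @ q) v \<longleftrightarrow> (\<exists>w. pcas u p w \<and> pcas w q v)"
  by (induct p arbitrary: u) auto

lemma last_in_pawalk_verts: "pcas u p v \<Longrightarrow> v \<in> set (pawalk_verts u p)"
  by (induct p arbitrary: u) auto

section \<open>Reachability after deleting a vertex set\<close>

locale cleavage_graph = pair_bidirected_digraph G for G :: "'a pair_pre_digraph" +
  fixes t :: nat
  assumes t_pos: "1 \<le> t"
    and cleavage: "cleavage_property t (with_proj G)"
begin

abbreviation V :: "'a set" where "V \<equiv> pverts G"
abbreviation E :: "'a rel" where "E \<equiv> parcs G"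
abbreviation separator :: "'a set \<Rightarrow> bool" where
  "separator X \<equiv> vertex_separator t (with_proj G) X"
abbreviation linked :: "'a set \<Rightarrow> 'a rel" where
  "linked S \<equiv> rtrancl_on (V - S) E"

lemma symmetric_G: "symmetric (with_proj G)"
  using pair_sym_arcs .

lemma wf_G: "wf_digraph (with_proj G)"
  by unfold_locales

lemma linked_in_verts: "(u, v) \<in> linked S \<Longrightarrow> u \<in> V - S \<and> v \<in> V - S"
  by (blast dest: in_rtrancl_on_in_F)

lemma linked_sym: "(u, v) \<in> linked S \<Longrightarrow> (v, u) \<in> linked S"
  using symmetric_G rtrancl_on_sym[of E] by (auto simp: symmetric_def dest: symD)

lemma linked_trans: "(u, v) \<in> linked S \<Longrightarrow> (v, w) \<in> linked S \<Longrightarrow> (u, w) \<in> linked S"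
  by (rule rtrancl_on_trans)

lemma linked_edge: "(u, v) \<in> E \<Longrightarrow> u \<notin> S \<Longrightarrow> v \<notin> S \<Longrightarrow> (u, v) \<in> linked S"
  using in_arcsD1 in_arcsD2 by (blast intro: rtrancl_on_into_rtrancl_on)

lemma connected_delete_iff:
  "connected (delete_verts (with_proj G) S) \<longleftrightarrow>
    V - S \<noteq> {} \<and> (\<forall>u \<in> V - S. \<forall>v \<in> V - S. (u, v) \<in> linked S)"
  using connected_induce_subgraph_iff[OF wf_G symmetric_G, of "V - S"]
  by (simp add: delete_verts_def)

lemma separatorD:
  assumes "separator X"
  shows "X \<subseteq> V" "finite X" "card X = t"
  using assms by (auto simp: vertex_separator_def)

lemma separator_clique:
  assumes "separator X" "x \<in> X" "y \<in> X" "x \<noteq> y"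
  shows "(x, y) \<in> E"
proof -
  have "arcs_ends (with_proj G \<restriction> X) = {(u, v). (u, v) \<in> X \<times> X \<and> u \<noteq> v}"
    using assms cleavage by (simp add: cleavage_property_def complete_digraph_def)
  then show ?thesis using assms by (auto simp: arcs_ends_induce_subgraph)
qed

lemma linked_small:
  assumes "S \<subseteq> V" "finite S" "card S < t" "u \<in> V - S" "v \<in> V - S"
  shows "(u, v) \<in> linked S"
  using assms cleavage connected_delete_iff[of S]
  by (auto simp: cleavage_property_def k_connected_def)

lemma linked_not_separator:
  assumes "S \<subseteq> V" "finite S" "card S \<le> t" "\<not> separator S" "u \<in> V - S" "v \<in> V - S"
  shows "(u, v) \<in> linked S"
proof (cases "card S < t")
  case True
  then show ?thesis using linked_small assms by blast
next
  case False
  then have "\<not> disconnected (delete_verts (with_proj G) S)"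
    using assms by (auto simp: vertex_separator_def)
  moreover have "verts (delete_verts (with_proj G) S) \<noteq> {}"
    using assms by (auto simp: delete_verts_def)
  ultimately show ?thesis
    using assms connected_delete_iff[of S] by (auto simp: disconnected_def)
qed

lemma separator_diff_nonempty:
  assumes "separator X" "separator Y" "X \<noteq> Y"
  shows "X - Y \<noteq> {}"
  using assms separatorD card_subset_eq[of Y X] by auto

section \<open>Inseparable sets and connectivity of the maximal ones\<close>

definition inseparable :: "'a set \<Rightarrow> bool" where
  "inseparable B \<longleftrightarrow>
    B \<subseteq> V \<and> (\<forall>X. separator X \<longrightarrow> (\<forall>u \<in> B - X. \<forall>v \<in> B - X. (u, v) \<in> linked X))"

definition max_inseparable :: "'a set \<Rightarrow> bool" where
  "max_inseparable B \<longleftrightarrow> inseparable B \<and> (\<forall>B'. inseparable B' \<and> B \<subseteq> B' \<longrightarrow> B' = B)"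

text \<open>By \<open>block_iff\<close> these are the vertex sets of the
  \<open>(t+1)\<close>-blocks.\<close>

definition blockset :: "'a set \<Rightarrow> bool" where
  "blockset B \<longleftrightarrow> max_inseparable B \<and> (infinite B \<or> t < card B)"

lemma inseparableD:
  "inseparable B \<Longrightarrow> separator X \<Longrightarrow> u \<in> B \<Longrightarrow> v \<in> B \<Longrightarrow> u \<notin> X \<Longrightarrow> v \<notin> X \<Longrightarrow> (u, v) \<in> linked X"
  by (auto simp: inseparable_def)

text \<open>Two vertices of a clique outside \<open>X\<close> are joined by an edge that avoids
  \<open>X\<close>.\<close>

lemma inseparable_clique:
  assumes "B \<subseteq> V" "\<And>x y. x \<in> B \<Longrightarrow> y \<in> B \<Longrightarrow> x \<noteq> y \<Longrightarrow> (x, y) \<in> E"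
  shows "inseparable B"
  unfolding inseparable_def
proof (intro conjI allI impI ballI)
  fix X u v
  assume "u \<in> B - X" "v \<in> B - X"
  then show "(u, v) \<in> linked X"
    using assms linked_edge by (cases "u = v") auto
qed (rule assms(1))

lemma separator_inseparable: "separator X \<Longrightarrow> inseparable X"
  using separator_clique separatorD(1) by (intro inseparable_clique) auto

text \<open>Zorn's lemma applies, since any two vertices in the union of a chain already lie in one
  member of it.\<close>

lemma max_inseparable_extend:
  assumes "inseparable A"
  shows "\<exists>B. A \<subseteq> B \<and> max_inseparable B"
proof -
  let ?F = "{B. inseparable B \<and> A \<subseteq> B}"
  have "\<exists>M \<in> ?F. \<forall>X \<in> ?F. M \<subseteq> X \<longrightarrow> X = M"
  proof (rule subset_Zorn_nonempty)
    show "?F \<noteq> {}" using assms by blast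
  next
    fix \<C> assume ne: "\<C> \<noteq> {}" and ch: "subset.chain ?F \<C>"
    have "(u, v) \<in> linked X" if "separator X" "u \<in> \<Union>\<C> - X" "v \<in> \<Union>\<C> - X" for X u v
    proof -
      from that obtain B B' where "B \<in> \<C>" "u \<in> B" "B' \<in> \<C>" "v \<in> B'" by blast
      then obtain D where "D \<in> \<C>" "u \<in> D" "v \<in> D"
        using ch unfolding subset.chain_def by blast
      moreover have "inseparable D" using \<open>D \<in> \<C>\<close> ch unfolding subset.chain_def by auto
      ultimately show ?thesis using that by (auto intro: inseparableD)
    qed
    moreover have "\<And>B. B \<in> \<C> \<Longrightarrow> inseparable B \<and> A \<subseteq> B"
      using ch unfolding subset.chain_def by auto
    then have "\<Union>\<C> \<subseteq> V" "A \<subseteq> \<Union>\<C>"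
      using ne unfolding inseparable_def by blast+
    ultimately show "\<Union>\<C> \<in> ?F" by (auto simp: inseparable_def)
  qed
  then show ?thesis unfolding max_inseparable_def by (metis (mono_tags) mem_Collect_eq order_trans)
qed

lemma blockset_extend:
  assumes "inseparable A" "infinite A \<or> t < card A"
  shows "\<exists>B. A \<subseteq> B \<and> blockset B"
proof -
  obtain B where B: "A \<subseteq> B" "max_inseparable B" using max_inseparable_extend[OF assms(1)] by blast
  have "infinite B \<or> t < card B"
    using assms(2) B(1) by (metis card_mono finite_subset less_le_trans)
  then show ?thesis using B by (auto simp: blockset_def)
qed

text \<open>A pair violating inseparability must contain \<open>w\<close>. As \<open>B - X\<close>
  lies in one component of \<open>G - X\<close>, a vertex separated from one of its elements is
  separated from all.\<close>

lemma separates_from_all: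
  assumes "inseparable B" "\<not> inseparable (insert w B)" "w \<in> V"
  obtains X b where "separator X" "w \<notin> X" "b \<in> B - X" "\<forall>b \<in> B - X. (w, b) \<notin> linked X"
proof -
  obtain X u v where X: "separator X" "u \<in> insert w B - X" "v \<in> insert w B - X" "(u, v) \<notin> linked X"
    using assms by (auto simp: inseparable_def)
  have refl: "(w, w) \<in> linked X" if "w \<notin> X" using that assms(3) by auto
  have "\<exists>b \<in> B - X. w \<notin> X \<and> (w, b) \<notin> linked X"
    using X refl linked_sym inseparableD[OF assms(1) X(1)] by (metis DiffD1 DiffD2 DiffI insertE)
  then obtain b where b: "b \<in> B - X" "w \<notin> X" "(w, b) \<notin> linked X" by blast
  have "(w, b') \<notin> linked X" if "b' \<in> B - X" for b'
    using b that inseparableD[OF assms(1) X(1), of b' b] linked_trans by blast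
  then show ?thesis using that X b by blast
qed

text \<open>A walk that leaves a maximal inseparable set \<open>B\<close> at \<open>u\<close> meets a separator twice, first in
  \<open>u\<close>; as separators are cliques, the walk can be shortened.\<close>

lemma walk_stays_in_max_inseparable:
  assumes "max_inseparable B" "u \<in> B - S" "v \<in> B - S" "(u, v) \<in> walk_step E (V - S) ^^ n"
  shows "(u, v) \<in> rtrancl_on (B - S) E"
  using assms(2-)
proof (induct n arbitrary: u rule: less_induct)
  case (less n)
  have B: "inseparable B" using assms by (simp add: max_inseparable_def)
  show ?case
  proof (cases n)
    case 0
    then show ?thesis using less by auto
  next
    case (Suc k)
    then obtain w where w: "(u, w) \<in> walk_step E (V - S)" "(w, v) \<in> walk_step E (V - S) ^^ k"
      using less.prems(3) by (meson relpow_Suc_D2)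
    then have w': "(u, w) \<in> E" "w \<in> V - S" "u \<in> V - S" by (auto simp: walk_step_def)
    show ?thesis
    proof (cases "w \<in> B")
      case True
      then have "(w, v) \<in> rtrancl_on (B - S) E"
        using less.hyps[of k w] Suc w w' less.prems by auto
      then show ?thesis
        using w' less.prems by (blast intro: converse_rtrancl_on_into_rtrancl_on)
    next
      case False
      then have "\<not> inseparable (insert w B)"
        using assms(1) by (auto simp: max_inseparable_def)
      then obtain X where X: "separator X" "w \<notin> X" "\<forall>b \<in> B - X. (w, b) \<notin> linked X"
        using separates_from_all[OF B] w' by blast
      \<comment> \<open>Otherwise the edge from \<open>u\<close> would link \<open>w\<close> to a
        vertex of \<open>B - X\<close>.\<close>
      have u: "u \<in> X"
        using X w' less.prems linked_edge[of u w X] linked_sym by blast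
      \<comment> \<open>Either \<open>v\<close> lies in \<open>X\<close> or \<open>X\<close>
        separates it from \<open>w\<close>, so the remaining walk has to come back to
        \<open>X\<close>.\<close>
      have "(w, v) \<notin> linked X"
        using X less.prems linked_in_verts by blast
      then obtain z m where z: "z \<in> X" "z \<in> V - S" "m < k" "(z, v) \<in> walk_step E (V - S) ^^ m"
        using walk_meets[OF w(2) w'(2) Diff_subset X(2)] by blast
      \<comment> \<open>A loop back to \<open>u\<close> is dropped; otherwise the edge from
        \<open>u\<close> to \<open>z\<close> replaces the detour. Both walks are shorter than
        \<open>n = Suc k\<close>, the second because \<open>m < k\<close>.\<close>
      show ?thesis
      proof (cases "z = u")
        case True
        then show ?thesis using less.hyps[of m u] z Suc less.prems by auto
      next
        case False
        then have "(u, z) \<in> walk_step E (V - S)"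
          using separator_clique[OF X(1) u z(1)] w' z by (auto simp: walk_step_def)
        then have "(u, v) \<in> walk_step E (V - S) ^^ Suc m"
          using z(4) by (rule relpow_Suc_I2)
        then show ?thesis using less.hyps[of "Suc m" u] z Suc less.prems by auto
      qed
    qed
  qed
qed

text \<open>The source of \<open>(t+1)\<close>-connectedness of blocks. If \<open>S\<close> is a
  separator, inseparability gives a walk in \<open>G - S\<close>; if not, \<open>S\<close> is too
  small to disconnect \<open>G\<close>. That walk is then shortened into \<open>B\<close>.\<close>

lemma max_inseparable_connected:
  assumes "max_inseparable B" "S \<subseteq> B" "finite S" "card S \<le> t" "u \<in> B - S" "v \<in> B - S"
  shows "(u, v) \<in> rtrancl_on (B - S) E"
proof -
  have B: "inseparable B" using assms(1) by (simp add: max_inseparable_def)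
  then have "B \<subseteq> V" by (simp add: inseparable_def)
  have "(u, v) \<in> linked S"
  proof (cases "separator S")
    case True
    then show ?thesis using B assms by (auto intro: inseparableD)
  next
    case False
    then show ?thesis using assms \<open>B \<subseteq> V\<close> by (intro linked_not_separator) auto
  qed
  then obtain n where "(u, v) \<in> walk_step E (V - S) ^^ n"
    using rtrancl_on_imp_walk by metis
  then show ?thesis by (rule walk_stays_in_max_inseparable[OF assms(1,5,6)])
qed

section \<open>Blocks that contain a given separator\<close>

text \<open>The \<open>t - 1\<close> vertices of \<open>X - {x}\<close> do not disconnect
  \<open>G\<close>, so \<open>c\<close> still reaches \<open>x\<close>. Without a neighbour of
  \<open>x\<close> in the component of \<open>c\<close>, that walk could never leave the
  component.\<close>

lemma separator_neighbour_in_component: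
  assumes "separator X" "c \<in> V - X" "x \<in> X"
  shows "\<exists>y. (c, y) \<in> linked X \<and> (y, x) \<in> E"
proof (rule ccontr)
  assume none: "\<not> ?thesis"
  have X: "X \<subseteq> V" "finite X" "card X = t" using separatorD[OF assms(1)] .
  have "(c, x) \<in> linked (X - {x})"
    using X assms t_pos by (intro linked_small) auto
  then have "(c, x) \<in> linked X"
  proof (induct rule: rtrancl_on_induct)
    case base
    then show ?case using assms by auto
  next
    case (step y z)
    then have "z \<noteq> x" using none by auto
    then show ?case using step by (auto intro: rtrancl_on_into_rtrancl_on)
  qed
  then show False using assms linked_in_verts by blast
qed

text \<open>Confining the walk to the component and \<open>x\<close> ensures that a vertex other
  than \<open>x\<close> at which a second separator meets it lies in the component again.\<close>

lemma component_walk: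
  assumes "(w, v) \<in> linked X" "(v, x) \<in> E" "x \<in> V"
  shows "\<exists>n. (w, x) \<in> walk_step E (insert x {y. (w, y) \<in> linked X}) ^^ n"
proof -
  let ?W = "insert x {y. (w, y) \<in> linked X}"
  have "(w, v) \<in> rtrancl_on ?W E"
    using assms(1)
  proof (induct rule: rtrancl_on_induct)
    case base
    then show ?case by auto
  next
    case (step y z)
    then have "(w, z) \<in> linked X" by (auto intro: rtrancl_on_into_rtrancl_on)
    then show ?case using step by (auto intro: rtrancl_on_into_rtrancl_on)
  qed
  then have "(w, x) \<in> rtrancl_on ?W E"
    using assms by (auto intro: rtrancl_on_into_rtrancl_on)
  then show ?thesis by (rule rtrancl_on_imp_walk)
qed

text \<open>Among the vertices of the component with the most neighbours in \<open>X\<close>, one that cannot be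
  separated from \<open>X\<close> is found by moving towards a non-neighbour \<open>x\<close>: a separator \<open>Y\<close> of \<open>w\<close> and \<open>X\<close>
  contains a vertex of the component nearer to \<open>x\<close>, with the same neighbours in \<open>X\<close>.\<close>

lemma separator_extends_into_component:
  assumes X: "separator X" and c: "c \<in> V - X"
  shows "\<exists>w. (c, w) \<in> linked X \<and> inseparable (insert w X)"
proof -
  define C where "C = {w. (c, w) \<in> linked X}"
  define N where "N w = {x \<in> X. (w, x) \<in> E}" for w
  have XV: "X \<subseteq> V" "finite X" "card X = t" using separatorD[OF X] .
  have CV: "C \<subseteq> V - X" using linked_in_verts by (auto simp: C_def)
  have comp: "{y. (w, y) \<in> linked X} = C" if "w \<in> C" for w
    using that linked_sym linked_trans unfolding C_def by blast
  have walk: "\<exists>n. (w, x) \<in> walk_step E (insert x C) ^^ n" if w: "w \<in> C" and x: "x \<in> X" for w x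
  proof -
    obtain y where "(w, y) \<in> linked X" "(y, x) \<in> E"
      using separator_neighbour_in_component[OF X _ x] CV w by blast
    then show ?thesis using component_walk[of w y X x] comp[OF w] x XV by auto
  qed
  have N_sub: "N w \<subseteq> X" "finite (N w)" for w using XV(2) by (auto simp: N_def)
  have "c \<in> C" using c by (auto simp: C_def)
  \<comment> \<open>The numbers of neighbours are at most \<open>t\<close>, so the maximum exists
    even if the component \<open>C\<close> is infinite.\<close>
  define M where "M = Max ((card \<circ> N) ` C)"
  have "card (N w) \<le> t" for w
    using card_mono[OF XV(2) N_sub(1)] XV(3) by simp
  then have bounded: "(card \<circ> N) ` C \<subseteq> {..t}" by auto
  then have fin: "finite ((card \<circ> N) ` C)" by (rule finite_subset) simp
  have le_M: "card (N w) \<le> M" if "w \<in> C" for w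
    unfolding M_def using fin that by (intro Max_ge) auto
  have "M \<in> (card \<circ> N) ` C"
    unfolding M_def using fin \<open>c \<in> C\<close> by (intro Max_in) auto
  then obtain w where w: "w \<in> C" "card (N w) = M" by auto
  have descent: "\<exists>w' \<in> C. inseparable (insert w' X)"
    if "w \<in> C" "card (N w) = M" "x \<in> X - N w" "(w, x) \<in> walk_step E (insert x C) ^^ n" for w x n
    using that
  proof (induct n arbitrary: w rule: less_induct)
    case (less n)
    show ?case
    proof (cases "inseparable (insert w X)")
      case True
      then show ?thesis using less.prems(1) by blast
    next
      case False
      have wV: "w \<in> V - X" using less.prems(1) CV by blast
      obtain Y b where Y: "separator Y" "w \<notin> Y" "b \<in> X - Y" "\<forall>b \<in> X - Y. (w, b) \<notin> linked Y"
        using separates_from_all[OF separator_inseparable[OF X] False] wV by blast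
      \<comment> \<open>A neighbour of \<open>w\<close> in \<open>X - Y\<close> would be linked to
        \<open>w\<close> in \<open>G - Y\<close>.\<close>
      have NY: "N w \<subseteq> Y \<inter> X"
        using Y linked_edge[of w] unfolding N_def by blast
      \<comment> \<open>The clique \<open>Y\<close> makes \<open>z\<close> adjacent to all of
        \<open>Y \<inter> X\<close>, which contains \<open>N w\<close>; maximality of
        \<open>card (N w)\<close> forces equality throughout.\<close>
      have NN: "Y \<inter> X = N w \<and> N z = N w" if z: "z \<in> Y" "z \<in> C" for z
      proof -
        have "Y \<inter> X \<subseteq> N z"
          using separator_clique[OF Y(1) z(1)] CV z(2) unfolding N_def by blast
        moreover have "N z = N w"
          using calculation NY le_M[OF z(2)] less.prems(2) N_sub(2)
          by (metis card_seteq dual_order.trans)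
        ultimately show ?thesis using NY by blast
      qed
      have meets: "\<exists>z \<in> Y \<inter> C. \<exists>m < k. (z, x') \<in> walk_step E (insert x' C) ^^ m"
        if "x' \<in> X - Y" "(w, x') \<in> walk_step E (insert x' C) ^^ k" for x' k
      proof -
        have "insert x' C \<subseteq> V" using that XV CV by blast
        from walk_meets[OF that(2) _ this Y(2)] show ?thesis
          using that(1) Y(4) less.prems(1) by blast
      qed
      \<comment> \<open>The walk to \<open>b\<close> only serves to find some vertex of
        \<open>Y\<close> in \<open>C\<close>. This gives \<open>Y \<inter> X = N w\<close>, hence
        \<open>x\<close> lies outside \<open>Y\<close>, and then the walk to \<open>x\<close> meets
        \<open>Y\<close> as well, at a vertex nearer to \<open>x\<close>.\<close>
      obtain k where "(w, b) \<in> walk_step E (insert b C) ^^ k"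
        using walk[OF less.prems(1), of b] Y(3) by blast
      then obtain z where "z \<in> Y" "z \<in> C" using meets[of b] Y(3) by blast
      then have "Y \<inter> X = N w" using NN by blast
      then have "x \<in> X - Y" using less.prems(3) by blast
      then obtain z m where z: "z \<in> Y" "z \<in> C" "m < n" "(z, x) \<in> walk_step E (insert x C) ^^ m"
        using meets less.prems(4) by blast
      then show ?thesis using less.hyps[of m z] NN[of z] less.prems by auto
    qed
  qed
  have "\<exists>w' \<in> C. inseparable (insert w' X)"
  proof (cases "N w = X")
    \<comment> \<open>There is no non-neighbour to move towards, but \<open>insert w X\<close> is a
      clique.\<close>
    case True
    have "(x, y) \<in> E" if "x \<in> insert w X" "y \<in> insert w X" "x \<noteq> y" for x y
      using that True separator_clique[OF X] arcs_symmetric unfolding N_def by blast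
    then have "inseparable (insert w X)"
      using w(1) CV XV by (intro inseparable_clique) auto
    then show ?thesis using w(1) by blast
  next
    case False
    then obtain x where "x \<in> X - N w" using N_sub(1) by blast
    then show ?thesis using descent[OF w] walk[OF w(1), of x] by blast
  qed
  then show ?thesis by (auto simp: C_def)
qed

text \<open>\<open>insert w X\<close> is inseparable and has \<open>t + 1\<close> vertices, just
  enough to extend to a block.\<close>

lemma separator_in_blockset:
  assumes "separator X" "c \<in> V - X"
  obtains B w where "blockset B" "X \<subseteq> B" "w \<in> B - X" "(c, w) \<in> linked X"
proof -
  obtain w where w: "(c, w) \<in> linked X" "inseparable (insert w X)"
    using separator_extends_into_component[OF assms] by blast
  have "w \<notin> X" using w linked_in_verts by blast
  then have "t < card (insert w X)" using separatorD[OF assms(1)] by simp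
  then obtain B where "insert w X \<subseteq> B" "blockset B" using blockset_extend w(2) by blast
  then show ?thesis using that w(1) \<open>w \<notin> X\<close> by blast
qed

lemma separator_outside:
  assumes "separator X"
  obtains c where "c \<in> V - X"
  using assms by (auto simp: vertex_separator_def disconnected_def delete_verts_def)

section \<open>Separators between two blocks\<close>

text \<open>A branching search with \<open>k\<close> vertices still to be chosen. While
  \<open>S\<close> has fewer than \<open>t\<close> vertices, a finite walk from \<open>u\<close> to
  \<open>v\<close> avoids it, and every separator counted contains an inner vertex of this walk,
  which joins \<open>S\<close>. At \<open>k = 0\<close> only \<open>S\<close> itself
  remains.\<close>

lemma finite_separators_between_aux:
  assumes "S \<subseteq> V - {u, v}" "finite S" "card S + k = t" "u \<in> V" "v \<in> V"
  shows "finite {Y. separator Y \<and> S \<subseteq> Y \<and> u \<notin> Y \<and> v \<notin> Y \<and> (u, v) \<notin> linked Y}"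
  using assms
proof (induct k arbitrary: S)
  case 0
  have "{Y. separator Y \<and> S \<subseteq> Y \<and> u \<notin> Y \<and> v \<notin> Y \<and> (u, v) \<notin> linked Y} \<subseteq> {S}"
    using 0 separatorD card_subset_eq[of _ S] by (metis (lifting) add_0_right insertI1 mem_Collect_eq subsetI)
  then show ?case by (rule finite_subset) simp
next
  case (Suc k)
  let ?A = "\<lambda>S. {Y. separator Y \<and> S \<subseteq> Y \<and> u \<notin> Y \<and> v \<notin> Y \<and> (u, v) \<notin> linked Y}"
  have "(u, v) \<in> linked S" using Suc.prems by (intro linked_small) auto
  then obtain P where P: "finite P" "P \<subseteq> V - S" "(u, v) \<in> rtrancl_on P E"
    using rtrancl_on_finite_support by metis
  have "\<exists>p \<in> P - {u, v}. p \<in> Y" if "Y \<in> ?A S" for Y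
  proof (rule ccontr)
    assume "\<not> ?thesis"
    then have "P \<subseteq> V - Y" using P that by auto
    then have "(u, v) \<in> linked Y" using rtrancl_on_mono[OF subset_refl _ P(3)] by blast
    then show False using that by blast
  qed
  then have "?A S \<subseteq> (\<Union>p \<in> P - {u, v}. ?A (insert p S))"
    by (smt (verit, best) UN_iff insert_subset mem_Collect_eq subsetI)
  moreover have "finite (?A (insert p S))" if "p \<in> P - {u, v}" for p
  proof (rule Suc.hyps)
    have "p \<notin> S" using that P(2) by blast
    then show "card (insert p S) + k = t" using Suc.prems by auto
  qed (use that P(2) Suc.prems in auto)
  ultimately show ?case using P(1) by (meson finite_Diff finite_UN finite_subset)
qed

lemma finite_separators_between:
  assumes "u \<in> V" "v \<in> V"
  shows "finite {Y. separator Y \<and> u \<notin> Y \<and> v \<notin> Y \<and> (u, v) \<notin> linked Y}"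
  using finite_separators_between_aux[of "{}" u v t] assms by simp

lemma blocksetD:
  assumes "blockset B"
  shows "max_inseparable B" "inseparable B" "B \<subseteq> V"
  using assms by (auto simp: blockset_def max_inseparable_def inseparable_def)

lemma blockset_diff_nonempty:
  assumes "blockset B" "separator X"
  shows "B - X \<noteq> {}"
  using assms card_mono[of X B] finite_subset[of B X] separatorD[OF assms(2)]
  by (auto simp: blockset_def)

definition between :: "'a set \<Rightarrow> 'a set \<Rightarrow> 'a set set" where
  "between B B' = {Y. separator Y \<and> (\<exists>u \<in> B - Y. \<exists>v \<in> B' - Y. (u, v) \<notin> linked Y)}"

lemma between_sym: "between B B' = between B' B"
  using linked_sym unfolding between_def by blast

text \<open>\<open>B - Y\<close> and \<open>B' - Y\<close> each lie in one component of
  \<open>G - Y\<close>, so the witnesses in \<open>between\<close> can be exchanged for any other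
  pair.\<close>

lemma betweenD:
  assumes "inseparable B" "inseparable B'" "Y \<in> between B B'" "u \<in> B - Y" "v \<in> B' - Y"
  shows "(u, v) \<notin> linked Y"
proof
  assume uv: "(u, v) \<in> linked Y"
  obtain u' v' where *: "separator Y" "u' \<in> B - Y" "v' \<in> B' - Y" "(u', v') \<notin> linked Y"
    using assms(3) by (auto simp: between_def)
  have "(u', u) \<in> linked Y" "(v, v') \<in> linked Y"
    using assms * by (auto intro: inseparableD)
  then show False using uv * linked_trans by blast
qed

text \<open>Otherwise \<open>B \<union> B'\<close> would be inseparable, and maximality would make
  it equal to both sets.\<close>

lemma between_nonempty:
  assumes "max_inseparable B" "max_inseparable B'" "B \<noteq> B'"
  shows "between B B' \<noteq> {}"
proof
  assume empty: "between B B' = {}"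
  have B: "inseparable B" "inseparable B'" using assms by (auto simp: max_inseparable_def)
  have "inseparable (B \<union> B')"
    unfolding inseparable_def
  proof (intro conjI allI impI ballI)
    show "B \<union> B' \<subseteq> V" using B by (auto simp: inseparable_def)
  next
    fix X u v
    assume X: "separator X" and uv: "u \<in> B \<union> B' - X" "v \<in> B \<union> B' - X"
    have cross: "(a, b) \<in> linked X" if "a \<in> B - X" "b \<in> B' - X" for a b
      using empty X that by (auto simp: between_def)
    show "(u, v) \<in> linked X"
      using uv B X cross linked_sym inseparableD by (metis Diff_iff Un_iff)
  qed
  then show False using assms unfolding max_inseparable_def by (metis Un_upper1 Un_upper2)
qed

lemma blockset_finite_part:
  assumes "blockset B"
  obtains A where "A \<subseteq> B" "finite A" "card A = Suc t"
proof (cases "finite B")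
  case True
  then show ?thesis using assms that obtain_subset_with_card_n[of "Suc t" B]
    by (auto simp: blockset_def)
next
  case False
  then show ?thesis using that infinite_arbitrarily_large by blast
qed

text \<open>No separator contains \<open>t + 1\<close> vertices, so each \<open>Y\<close> between
  the blocks separates one of the finitely many pairs in \<open>A \<times> A'\<close>.\<close>

lemma finite_between:
  assumes "blockset B" "blockset B'"
  shows "finite (between B B')"
proof -
  obtain A where A: "A \<subseteq> B" "finite A" "card A = Suc t" using blockset_finite_part assms by blast
  obtain A' where A': "A' \<subseteq> B'" "finite A'" "card A' = Suc t" using blockset_finite_part assms by blast
  let ?F = "\<lambda>(u, v). {Y. separator Y \<and> u \<notin> Y \<and> v \<notin> Y \<and> (u, v) \<notin> linked Y}"
  have "between B B' \<subseteq> (\<Union>p \<in> A \<times> A'. ?F p)"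
  proof
    fix Y assume Y: "Y \<in> between B B'"
    then have sep: "separator Y" by (simp add: between_def)
    have "\<not> A \<subseteq> Y" "\<not> A' \<subseteq> Y"
      using A A' separatorD[OF sep] card_mono[of Y A] card_mono[of Y A'] by auto
    then obtain u v where "u \<in> A - Y" "v \<in> A' - Y" by blast
    then show "Y \<in> (\<Union>p \<in> A \<times> A'. ?F p)"
      using betweenD[OF blocksetD(2)[OF assms(1)] blocksetD(2)[OF assms(2)] Y, of u v] sep A A'
      by auto
  qed
  moreover have "finite (?F p)" if "p \<in> A \<times> A'" for p
    using that A A' blocksetD(3)[OF assms(1)] blocksetD(3)[OF assms(2)]
    by (cases p) (auto intro!: finite_separators_between)
  ultimately show ?thesis using A A' by (meson finite_SigmaI finite_UN finite_subset)
qed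

text \<open>The component of \<open>u\<close> in \<open>G - Y\<close> contains no vertex of
  \<open>X\<close>, so every walk in it avoids \<open>X\<close> too.\<close>

lemma linked_avoiding:
  assumes "(u, v) \<in> linked Y" "\<forall>x \<in> X - Y. (u, x) \<notin> linked Y"
  shows "(u, v) \<in> linked X"
  using assms(1)
proof (induct rule: rtrancl_on_induct)
  case base
  then show ?case using assms(2) by auto
next
  case (step y z)
  then have "(u, z) \<in> linked Y" by (blast intro: rtrancl_on_into_rtrancl_on)
  then have "z \<notin> X" using assms(2) step by blast
  then show ?case using step by (blast intro: rtrancl_on_into_rtrancl_on)
qed

text \<open>If \<open>Y\<close> separates \<open>B\<close> from \<open>B1\<close>, it separates
  \<open>B\<close> from \<open>X - Y\<close>. A walk from \<open>B\<close> to \<open>B'\<close> in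
  \<open>G - Y\<close> would then avoid \<open>X\<close> and link \<open>u\<close> to
  \<open>v\<close>. The inclusion is strict because \<open>X\<close> lies between \<open>B\<close>
  and \<open>B'\<close>, but not between \<open>B\<close> and \<open>B1\<close>.\<close>

lemma between_psubset:
  assumes "blockset B" "blockset B'" "blockset B1"
    and X: "separator X" "X \<subseteq> B1"
    and u: "u \<in> B - X" and v: "v \<in> B' - X" and uv: "(u, v) \<notin> linked X"
    and w: "w \<in> B1 - X" "(u, w) \<in> linked X"
  shows "between B B1 \<subset> between B B'"
proof
  have ins: "inseparable B" "inseparable B'" "inseparable B1" using assms(1-3) blocksetD by auto
  have X_notin: "X \<notin> between B B1" using betweenD[OF ins(1,3) _ u w(1)] w(2) by blast
  have X_in: "X \<in> between B B'" using X u v uv by (auto simp: between_def)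
  show "between B B1 \<subseteq> between B B'"
  proof
    fix Y assume Y: "Y \<in> between B B1"
    then have sep: "separator Y" by (simp add: between_def)
    obtain b where b: "b \<in> B - Y" using blockset_diff_nonempty[OF assms(1) sep] by blast
    obtain b' where b': "b' \<in> B' - Y" using blockset_diff_nonempty[OF assms(2) sep] by blast
    have bx: "\<forall>x \<in> X - Y. (b, x) \<notin> linked Y"
      using betweenD[OF ins(1,3) Y b] X(2) by blast
    have "(b, b') \<notin> linked Y"
    proof
      assume "(b, b') \<in> linked Y"
      then have l: "(b, b') \<in> linked X" using bx linked_avoiding by blast
      then have "b \<notin> X" "b' \<notin> X" using linked_in_verts by auto
      then have "(u, b) \<in> linked X" "(b', v) \<in> linked X"
        using ins X(1) u v b b' by (auto intro: inseparableD)
      then show False using l uv linked_trans by blast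
    qed
    then show "Y \<in> between B B'" using sep b b' by (auto simp: between_def)
  qed
  show "between B B1 \<noteq> between B B'" using X_in X_notin by blast
qed

section \<open>Chains of blocks and shared separators\<close>

definition share_separator :: "'a set rel" where
  "share_separator = {(B, B'). blockset B \<and> blockset B' \<and> (\<exists>X. separator X \<and> X \<subseteq> B \<inter> B')}"

text \<open>Choose \<open>X\<close> between \<open>B\<close> and \<open>B'\<close>, and blocks
  \<open>B1\<close>, \<open>B2\<close> containing \<open>X\<close> and reaching into the components
  of \<open>G - X\<close> that meet \<open>B\<close> and \<open>B'\<close>. By
  \<open>between_psubset\<close> induction joins \<open>B\<close> to \<open>B1\<close> and
  \<open>B2\<close> to \<open>B'\<close>, while \<open>B1\<close> and \<open>B2\<close> share
  \<open>X\<close>.\<close>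

lemma blocksets_linked:
  assumes "blockset B" "blockset B'"
  shows "(B, B') \<in> share_separator\<^sup>*"
  using assms
proof (induct "card (between B B')" arbitrary: B B' rule: less_induct)
  case less
  show ?case
  proof (cases "B = B'")
    case True
    then show ?thesis by simp
  next
    case False
    then obtain X where Xb: "X \<in> between B B'"
      using between_nonempty blocksetD(1) less.prems by blast
    then obtain u v where X: "separator X" and uv: "u \<in> B - X" "v \<in> B' - X" "(u, v) \<notin> linked X"
      by (auto simp: between_def)
    have V: "u \<in> V - X" "v \<in> V - X" using uv less.prems blocksetD(3) by auto
    obtain B1 w1 where B1: "blockset B1" "X \<subseteq> B1" "w1 \<in> B1 - X" "(u, w1) \<in> linked X"
      using separator_in_blockset[OF X V(1)] by blast
    obtain B2 w2 where B2: "blockset B2" "X \<subseteq> B2" "w2 \<in> B2 - X" "(v, w2) \<in> linked X"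
      using separator_in_blockset[OF X V(2)] by blast
    have fin: "finite (between B B')" using finite_between less.prems by blast
    have "between B B1 \<subset> between B B'"
      using between_psubset[OF less.prems B1(1) X B1(2) uv B1(3,4)] .
    then have 1: "(B, B1) \<in> share_separator\<^sup>*"
      using less.hyps less.prems B1(1) fin psubset_card_mono by blast
    have vu: "(v, u) \<notin> linked X" using uv(3) linked_sym by blast
    have "between B' B2 \<subset> between B' B"
      using between_psubset[OF less.prems(2,1) B2(1) X B2(2) uv(2,1) vu B2(3,4)] .
    then have "between B2 B' \<subset> between B B'" by (simp add: between_sym)
    then have 2: "(B2, B') \<in> share_separator\<^sup>*"
      using less.hyps less.prems B2(1) fin psubset_card_mono by blast
    have "(B1, B2) \<in> share_separator"
      using B1 B2 X by (auto simp: share_separator_def)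
    then show ?thesis using 1 2 by (meson rtrancl.rtrancl_into_rtrancl rtrancl_trans)
  qed
qed

text \<open>Any \<open>Y\<close> between the blocks contains their common vertices, as such a vertex
  outside \<open>Y\<close> would be linked to itself. So it contains \<open>X\<close>, and equal
  cardinality gives \<open>X = Y\<close>.\<close>

lemma blocksets_through_separator_not_linked:
  assumes "blockset B" "blockset B'" "B \<noteq> B'" "separator X" "X \<subseteq> B \<inter> B'"
    and "u \<in> B - X" "v \<in> B' - X"
  shows "(u, v) \<notin> linked X"
proof -
  have ins: "inseparable B" "inseparable B'" using assms blocksetD by auto
  obtain Y where Y: "Y \<in> between B B'"
    using between_nonempty assms blocksetD(1) by blast
  then have sep: "separator Y" by (simp add: between_def)
  have "X \<subseteq> Y"
  proof
    fix x assume x: "x \<in> X"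
    show "x \<in> Y"
    proof (rule ccontr)
      assume "x \<notin> Y"
      then show False
        using betweenD[OF ins Y, of x x] x assms(5) separatorD(1)[OF assms(4)] by auto
    qed
  qed
  then have "X = Y" using separator_diff_nonempty assms(4) sep by blast
  then show ?thesis using betweenD[OF ins Y] assms by blast
qed

section \<open>Blocks as induced subgraphs\<close>

definition induced :: "'a set \<Rightarrow> 'a pair_pre_digraph" where
  "induced B = \<lparr> pverts = B, parcs = E \<inter> B \<times> B \<rparr>"

lemma pverts_induced [simp]: "pverts (induced B) = B"
  by (simp add: induced_def)

lemma with_proj_induced: "with_proj (induced B) = with_proj G \<restriction> B"
  by (auto simp: with_proj_def induced_def induce_subgraph_def)

text \<open>The property for which \<open>block (t + 1)\<close> asks maximality.\<close>

definition block_like :: "('a, 'a \<times> 'a) pre_digraph \<Rightarrow> bool" where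
  "block_like H \<longleftrightarrow> symmetric H \<and> (complete_digraph (t + 1) H \<or> k_connected (t + 1) H)"

lemma block_like_induced:
  assumes "blockset B"
  shows "block_like (with_proj G \<restriction> B)"
proof -
  have max: "max_inseparable B" using assms by (simp add: blockset_def)
  have conn: "connected (delete_verts (with_proj G \<restriction> B) S)"
    if S: "S \<subseteq> B" "finite S" "card S < t + 1" for S
  proof -
    have eq: "rtrancl_on (B - S) (E \<inter> B \<times> B) = rtrancl_on (B - S) E"
      using rtrancl_on_restrict[of "B - S" "E \<inter> B \<times> B"] rtrancl_on_restrict[of "B - S" E]
      by (metis (no_types, lifting) Diff_subset Sigma_mono inf.absorb2 inf_assoc)
    have "B - S \<noteq> {}"
      using assms S card_mono[of S B] finite_subset[of B S] by (auto simp: blockset_def)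
    moreover have "(u, v) \<in> rtrancl_on (B - S) E" if "u \<in> B - S" "v \<in> B - S" for u v
      using max_inseparable_connected[OF max S(1,2) _ that] S(3) by simp
    moreover have "wf_digraph (with_proj G \<restriction> B)"
      using wf_digraph.wellformed_induce_subgraph[OF wf_G] .
    ultimately show ?thesis
      using connected_induce_subgraph_iff[OF _ symmetric_induce_subgraph[OF symmetric_G], of B "B - S"]
      by (simp add: delete_verts_def arcs_ends_induce_subgraph eq)
  qed
  \<comment> \<open>With only \<open>t + 1\<close> vertices the graph is too small to be
    \<open>(t+1)\<close>-connected, so it has to be complete.\<close>
  have "complete_digraph (t + 1) (with_proj G \<restriction> B)" if B: "finite B" "card B = t + 1"
  proof -
    have "(u, v) \<in> E" if uv: "u \<in> B" "v \<in> B" "u \<noteq> v" for u v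
    proof -
      \<comment> \<open>Deleting all other vertices of \<open>B\<close> leaves a walk inside
        \<open>{u, v}\<close>, which must use the edge.\<close>
      have "card (B - {u, v}) = t - 1" using B uv by (simp add: card_Diff_subset)
      then have "(u, v) \<in> rtrancl_on (B - (B - {u, v})) E"
        using B uv by (intro max_inseparable_connected[OF max]) auto
      moreover have "B - (B - {u, v}) = {u, v}" using uv by blast
      ultimately have "(u, v) \<in> rtrancl_on {u, v} E" by simp
      then show ?thesis
      proof (cases rule: converse_rtrancl_on_cases)
        case base
        then show ?thesis using uv by simp
      next
        case (step c)
        then have "c \<in> {u, v}" using in_rtrancl_on_in_F by metis
        then show ?thesis using step pair_no_loops[of "(u, u)"] by auto
      qed
    qed
    then have "parcs (induced B) = {(u, v). (u, v) \<in> B \<times> B \<and> u \<noteq> v}"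
      using pair_no_loops[of "(_, _)"] by (fastforce simp: induced_def)
    then show ?thesis
      using B complete_digraph_pair_def[of "t + 1" "induced B"] by (simp add: with_proj_induced)
  qed
  moreover have "k_connected (t + 1) (with_proj G \<restriction> B)" if "infinite B \<or> t + 1 < card B"
    using that conn by (auto simp: k_connected_def)
  moreover have "infinite B \<or> t + 1 < card B \<or> finite B \<and> card B = t + 1"
    using assms by (auto simp: blockset_def)
  ultimately show ?thesis
    using symmetric_induce_subgraph[OF symmetric_G, of B] unfolding block_like_def by blast
qed

text \<open>A separator meets \<open>H\<close> in at most \<open>t\<close> vertices, too few to
  disconnect a \<open>(t+1)\<close>-connected graph; the complete case is
  \<open>inseparable_clique\<close>.\<close>

lemma block_like_inseparable:
  assumes "subgraph H (with_proj G)" "block_like H"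
  shows "inseparable (verts H)" "infinite (verts H) \<or> t < card (verts H)"
proof -
  have wf: "wf_digraph H" and sub: "verts H \<subseteq> V" and sym: "symmetric H"
    using assms by (auto simp: subgraph_def block_like_def)
  have arcs: "arcs_ends H \<subseteq> E" using arcs_ends_mono[OF assms(1)] by simp
  show "infinite (verts H) \<or> t < card (verts H)"
    using assms(2) by (auto simp: block_like_def complete_digraph_def k_connected_def)
  show "inseparable (verts H)"
  proof (cases "complete_digraph (t + 1) H")
    case True
    then have "arcs_ends H = {(u, v). (u, v) \<in> verts H \<times> verts H \<and> u \<noteq> v}"
      by (simp add: complete_digraph_def)
    then show ?thesis using arcs sub by (intro inseparable_clique) auto
  next
    case False
    then have k: "k_connected (t + 1) H" using assms(2) by (simp add: block_like_def)
    show ?thesis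
      unfolding inseparable_def
    proof (intro conjI allI impI ballI)
      fix X u v
      assume X: "separator X" and uv: "u \<in> verts H - X" "v \<in> verts H - X"
      have "card (X \<inter> verts H) < t + 1" "finite (X \<inter> verts H)"
        using separatorD[OF X] card_mono[of X "X \<inter> verts H"] by auto
      then have "connected (delete_verts H (X \<inter> verts H))"
        using k by (auto simp: k_connected_def)
      moreover have "verts H - X \<inter> verts H = verts H - X" by blast
      ultimately have "(u, v) \<in> rtrancl_on (verts H - X) (arcs_ends H)"
        using connected_induce_subgraph_iff[OF wf sym] uv by (simp add: delete_verts_def)
      then show "(u, v) \<in> linked X"
        using sub by (intro rtrancl_on_mono[OF arcs, of "verts H - X"]) auto
    qed (rule sub)
  qed
qed

text \<open>A block \<open>D\<close> lies in the graph induced by some \<open>blockset\<close>, and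
  its maximality gives equality. Conversely, a larger candidate has an inseparable vertex set, hence
  the same vertices, and an induced subgraph already has all arcs.\<close>

lemma block_iff: "block (t + 1) G D \<longleftrightarrow> (\<exists>B. blockset B \<and> D = induced B)"
proof -
  have block_def': "block (t + 1) G D \<longleftrightarrow> max_subgraph block_like (with_proj D)" for D
    by (simp add: block_def block_like_def[abs_def])
  have sub_induced: "subgraph (with_proj G \<restriction> B) (with_proj G)" if "B \<subseteq> V" for B
    using that wf_digraph.induced_induce[OF wf_G, of B] induced_imp_subgraph by auto
  have sub_arcs: "arcs H \<subseteq> arcs (with_proj G \<restriction> verts H)" if "subgraph H (with_proj G)" for H
    using that by (auto simp: subgraph_def compatible_def dest: wf_digraph.wellformed)
  show ?thesis
  proof
    assume "block (t + 1) G D"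
    then have D: "subgraph (with_proj D) (with_proj G)" "block_like (with_proj D)"
      and D_max: "\<And>H. H \<noteq> with_proj D \<Longrightarrow> subgraph (with_proj D) H \<Longrightarrow>
        \<not> (subgraph H (with_proj G) \<and> block_like H)"
      unfolding block_def' max_subgraph_def by blast+
    obtain B where B: "pverts D \<subseteq> B" "blockset B"
      using blockset_extend[OF block_like_inseparable[OF D]] by auto
    have "subgraph (with_proj D) (with_proj G \<restriction> B)"
    proof (rule subgraphI)
      show "arcs (with_proj D) \<subseteq> arcs (with_proj G \<restriction> B)" using sub_arcs[OF D(1)] B(1) by auto
    qed (use D B wf_digraph.wellformed_induce_subgraph[OF wf_G] in
        \<open>auto simp: subgraph_def compatible_def\<close>)
    then have "with_proj G \<restriction> B = with_proj D"
      using D_max block_like_induced[OF B(2)] sub_induced[OF blocksetD(3)[OF B(2)]] by blast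
    then have "D = induced B"
      unfolding with_proj_induced[symmetric] by (cases D) (auto simp: with_proj_def induced_def)
    then show "\<exists>B. blockset B \<and> D = induced B" using B(2) by blast
  next
    assume "\<exists>B. blockset B \<and> D = induced B"
    then obtain B where B: "blockset B" and D: "with_proj D = with_proj G \<restriction> B"
      by (auto simp: with_proj_induced)
    have "H = with_proj G \<restriction> B"
      if H: "subgraph (with_proj G \<restriction> B) H" "subgraph H (with_proj G)" "block_like H" for H
    proof -
      have "B \<subseteq> verts H" using H(1) by (auto simp: subgraph_def)
      then have "verts H = B"
        using block_like_inseparable(1)[OF H(2,3)] blocksetD(1)[OF B]
        by (auto simp: max_inseparable_def)
      moreover have "arcs H = arcs (with_proj G \<restriction> verts H)"
        using H(1) sub_arcs[OF H(2)] calculation by (auto simp: subgraph_def)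
      moreover have "tail H = fst" "head H = snd" using H(2) by (auto simp: subgraph_def compatible_def)
      ultimately show ?thesis by (intro pre_digraph.equality) auto
    qed
    then show "block (t + 1) G D"
      using B D block_like_induced sub_induced[OF blocksetD(3)[OF B]]
      unfolding block_def' max_subgraph_def by auto
  qed
qed

section \<open>The block-separator graph is a tree\<close>

abbreviation T :: "('a pair_pre_digraph + 'a set) pair_pre_digraph" where
  "T \<equiv> block_separator_graph t G"

text \<open>As in a tree decomposition: it lets a walk in \<open>T\<close> be followed in
  \<open>G\<close>.\<close>

definition bag :: "'a pair_pre_digraph + 'a set \<Rightarrow> 'a set" where
  "bag a = case_sum pverts id a"

lemma bag_simps [simp]: "bag (Inl D) = pverts D" "bag (Inr X) = X"
  by (simp_all add: bag_def)

lemma Inl_in_T: "Inl D \<in> pverts T \<longleftrightarrow> (\<exists>B. blockset B \<and> D = induced B)"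
  unfolding block_iff[symmetric] by (auto simp: block_separator_graph_def)

lemma Inr_in_T: "Inr X \<in> pverts T \<longleftrightarrow> separator X"
  by (auto simp: block_separator_graph_def)

lemma T_arc_iff:
  "(a, b) \<in> parcs T \<longleftrightarrow> (\<exists>B X. blockset B \<and> separator X \<and> X \<subseteq> B \<and>
    (a = Inl (induced B) \<and> b = Inr X \<or> a = Inr X \<and> b = Inl (induced B)))"
proof -
  have "(a, b) \<in> parcs T \<longleftrightarrow> (\<exists>D X. block (t + 1) G D \<and> separator X \<and> X \<subseteq> pverts D \<and>
    (a = Inl D \<and> b = Inr X \<or> a = Inr X \<and> b = Inl D))"
    by (auto simp: block_separator_graph_def)
  then show ?thesis unfolding block_iff by (metis pverts_induced)
qed

lemma pair_bidirected_T: "pair_bidirected_digraph T"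
proof
  show "symmetric (with_proj T)"
    unfolding symmetric_def with_proj_simps by (rule symI) (metis T_arc_iff)
next
  fix e assume e: "e \<in> parcs T"
  obtain a b where ab: "e = (a, b)" by fastforce
  then have "(a, b) \<in> parcs T" using e by simp
  then show "fst e \<in> pverts T" "snd e \<in> pverts T" "fst e \<noteq> snd e"
    unfolding T_arc_iff ab by (auto simp: Inl_in_T Inr_in_T)
qed

lemma induced_reachable_in_T:
  assumes "blockset B" "blockset B'"
  shows "(Inl (induced B), Inl (induced B')) \<in> rtrancl_on (pverts T) (parcs T)"
  using blocksets_linked[OF assms]
proof (induct rule: rtrancl_induct)
  case base
  then show ?case using assms by (auto simp: Inl_in_T)
next
  case (step B1 B2)
  then obtain X where X: "blockset B1" "blockset B2" "separator X" "X \<subseteq> B1" "X \<subseteq> B2"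
    by (auto simp: share_separator_def)
  have "(Inl (induced B1), Inr X) \<in> parcs T" "(Inr X, Inl (induced B2)) \<in> parcs T"
    using X by (auto simp: T_arc_iff)
  moreover have "Inr X \<in> pverts T" "Inl (induced B2) \<in> pverts T"
    using X by (auto simp: Inl_in_T Inr_in_T)
  ultimately show ?case using step by (blast intro: rtrancl_on_into_rtrancl_on)
qed

lemma connected_T: "connected (with_proj T)"
proof -
  interpret T: pair_bidirected_digraph T by (rule pair_bidirected_T)
  let ?R = "rtrancl_on (pverts T) (parcs T)"
  have sym: "sym ?R"
    using T.pair_sym_arcs by (auto simp: symmetric_def intro: rtrancl_on_sym)
  have near: "\<exists>B. blockset B \<and> (a, Inl (induced B)) \<in> ?R" if a: "a \<in> pverts T" for a
  proof (cases a)
    case (Inl D)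
    then show ?thesis using a Inl_in_T[of D] by auto
  next
    case (Inr X)
    then have X: "separator X" using a by (simp add: Inr_in_T)
    \<comment> \<open>Any component of \<open>G - X\<close> will do.\<close>
    obtain B where B: "blockset B" "X \<subseteq> B"
      using separator_outside[OF X] separator_in_blockset[OF X] by metis
    then have "(a, Inl (induced B)) \<in> parcs T" using Inr X by (auto simp: T_arc_iff)
    then have "(a, Inl (induced B)) \<in> ?R"
      using T.in_arcsD1 T.in_arcsD2 by (blast intro: rtrancl_on_into_rtrancl_on)
    then show ?thesis using B by blast
  qed
  have "(a, b) \<in> ?R" if "a \<in> pverts T" "b \<in> pverts T" for a b
  proof -
    obtain B B' where "blockset B" "(a, Inl (induced B)) \<in> ?R"
      "blockset B'" "(b, Inl (induced B')) \<in> ?R"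
      using near \<open>a \<in> pverts T\<close> \<open>b \<in> pverts T\<close> by metis
    then show ?thesis
      using induced_reachable_in_T[of B B'] sym by (meson rtrancl_on_trans symD)
  qed
  moreover have "pverts T \<noteq> {}"
  proof (cases "\<exists>X. separator X")
    case True
    then show ?thesis using Inr_in_T by blast
  next
    \<comment> \<open>Without separators all of \<open>V\<close> is inseparable, and
      \<open>T\<close> still has a block as a vertex.\<close>
    case False
    then have "inseparable V" by (auto simp: inseparable_def)
    moreover have "infinite V \<or> t < card V"
      using cleavage by (auto simp: cleavage_property_def k_connected_def)
    ultimately obtain B where "blockset B" using blockset_extend by blast
    then show ?thesis using Inl_in_T by blast
  qed
  ultimately show ?thesis
    using connected_iff_rtrancl_on[of "with_proj T"] T.wf_digraph T.pair_sym_arcs by simp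
qed

text \<open>Each arc of the walk uses a separator \<open>Y\<close> different from \<open>X\<close>.
  A vertex of \<open>Y - X\<close> lies in both bags and carries the link on from one bag to the
  next.\<close>

lemma T_walk_avoiding_separator:
  assumes "separator X" "set p \<subseteq> parcs T" "pcas a p b" "a \<in> pverts T"
    and "Inr X \<notin> set (pawalk_verts a p)" "u \<in> bag a - X" "v \<in> bag b - X"
  shows "(u, v) \<in> linked X"
  using assms(2-)
proof (induct p arbitrary: a u)
  case Nil
  have "inseparable (bag a)"
  proof (cases a)
    case (Inl D)
    then show ?thesis using Nil.prems(3) blocksetD(2) Inl_in_T[of D] by auto
  next
    case (Inr Y)
    then show ?thesis using Nil.prems(3) separator_inseparable Inr_in_T[of Y] by auto
  qed
  then show ?case using Nil.prems assms(1) by (auto intro: inseparableD)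
next
  case (Cons e p)
  then obtain a' where e: "e = (a, a')" and arc: "(a, a') \<in> parcs T" by (cases e) auto
  have av: "a \<noteq> Inr X" using Cons.prems(4) e by auto
  have "a' \<in> set (pawalk_verts a' p)" by (cases p) (use Cons.prems e in auto)
  then have a'v: "a' \<noteq> Inr X" using Cons.prems(4) e by auto
  obtain B Y where BY: "blockset B" "separator Y" "Y \<subseteq> B"
    and ends: "a = Inl (induced B) \<and> a' = Inr Y \<or> a = Inr Y \<and> a' = Inl (induced B)"
    using arc by (auto simp: T_arc_iff)
  have "Y \<noteq> X" using ends av a'v by auto
  then obtain y where y: "y \<in> Y - X" using separator_diff_nonempty[OF BY(2) assms(1)] by blast
  have "(u, y) \<in> linked X"
    using ends BY y Cons.prems(5) assms(1)
    by (intro inseparableD[OF blocksetD(2)[OF BY(1)] assms(1)]) auto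
  moreover have "a' \<in> pverts T" using ends BY by (auto simp: Inl_in_T Inr_in_T)
  moreover have "y \<in> bag a' - X" using ends y BY by auto
  ultimately show ?case
    using Cons.hyps[of a' y] Cons.prems e linked_trans by auto
qed

text \<open>The distinct blocks \<open>a\<close> and \<open>b\<close> both contain \<open>X\<close>,
  so they lie in different components of \<open>G - X\<close>, which a walk avoiding
  \<open>X\<close> cannot join.\<close>

lemma no_return_to_separator:
  assumes "(Inr X, a) \<in> parcs T" "(b, Inr X) \<in> parcs T" "a \<noteq> b"
    and "set p \<subseteq> parcs T" "pcas a p b"
  shows "Inr X \<in> set (pawalk_verts a p)"
proof (rule ccontr)
  assume avoid: "Inr X \<notin> set (pawalk_verts a p)"
  obtain A B where A: "a = Inl (induced A)" "blockset A" "X \<subseteq> A"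
    and B: "b = Inl (induced B)" "blockset B" "X \<subseteq> B" and X: "separator X"
    using assms(1,2) by (auto simp: T_arc_iff)
  have "A \<noteq> B" using A B assms(3) by auto
  obtain u v where uv: "u \<in> A - X" "v \<in> B - X"
    using blockset_diff_nonempty A B X by blast
  have "(u, v) \<in> linked X"
    using T_walk_avoiding_separator[OF X assms(4,5) _ avoid] A B uv by (auto simp: Inl_in_T)
  then show False
    using blocksets_through_separator_not_linked[OF A(2) B(2) \<open>A \<noteq> B\<close> X _ uv] A B by auto
qed

lemma acyclic_T: "\<not> (\<exists>p. pre_digraph.cycle (with_proj T) p \<and> 3 \<le> length p)"
proof
  assume "\<exists>p. pre_digraph.cycle (with_proj T) p \<and> 3 \<le> length p"
  then obtain p a where p: "set p \<subseteq> parcs T" "pcas a p a" "distinct (tl (pawalk_verts a p))" "3 \<le> length p"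
    by (auto simp: pre_digraph.cycle_def pre_digraph.awalk_def cas_with_proj_eq awalk_verts_with_proj_eq)
  obtain b c q where p_eq: "p = (a, b) # (b, c) # q" and q: "q \<noteq> []" "pcas c q a"
    using p(2,4) by (cases p rule: remdups_adj.cases) (auto simp: Suc_le_eq)
  have dist: "b \<notin> set (pawalk_verts c q)" "distinct (pawalk_verts c q)"
    using p(3) by (auto simp: p_eq)
  \<comment> \<open>The vertex \<open>a\<close> ends the nonempty walk \<open>q\<close>, whose
    vertices are distinct. Here length at least 3 rules out an edge traversed back and
    forth.\<close>
  have "c \<noteq> a"
    using q dist(2) last_in_pawalk_verts[of _ "tl q" a] by (cases q) auto
  show False
  \<comment> \<open>One of the consecutive vertices \<open>a\<close>, \<open>b\<close> is a
    separator. The rest of the cycle joins its two neighbours without passing through it: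
    \<open>q\<close> from \<open>c\<close> to \<open>a\<close> if it is \<open>b\<close>, and the
    cycle without its first and last arcs if it is \<open>a\<close>.\<close>
  proof (cases b)
    case (Inr X)
    then show False
      using no_return_to_separator[of X c a q] p(1) q \<open>c \<noteq> a\<close> dist(1) by (auto simp: p_eq)
  next
    case (Inl D)
    then obtain X where X: "a = Inr X" using p(1) by (auto simp: p_eq T_arc_iff)
    obtain q' d where q': "q = q' @ [(d, a)]" "pcas c q' d"
      using q by (cases q rule: rev_cases) (auto simp: pcas_append)
    have verts: "pawalk_verts c q = pawalk_verts c q' @ [a]"
      using q'(2) unfolding q'(1) by (induct q' arbitrary: c) auto
    then have "Inr X \<notin> set (pawalk_verts b ((b, c) # q'))"
      using dist Inl X by auto
    moreover have "b \<noteq> d" using dist(1) verts last_in_pawalk_verts[OF q'(2)] by auto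
    ultimately show False
      using no_return_to_separator[of X b d "(b, c) # q'"] p(1) q' X by (auto simp: p_eq)
  qed
qed

end

theorem theorem4p2:
  fixes t :: nat and G :: "'a pair_pre_digraph"
  assumes "1 \<le> t"
    and "pair_bidirected_digraph G"
    and "cleavage_property t (with_proj G)"
  shows "undirected_tree (block_separator_graph t G)"
proof -
  interpret cleavage_graph G t
    using assms by (simp add: cleavage_graph_def cleavage_graph_axioms_def)
  show ?thesis
    using pair_bidirected_T connected_T acyclic_T by (simp add: undirected_tree_def)
qed

end
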